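(* Consider the one-dimensional isentropic two-velocity two-fluid system $$(\alpha^\pm\rho^\pm)_t+(\alpha^\pm\rho^\pm u^\pm)_x=0,\qquad (\alpha^\pm\rho^\pm u^\pm)_t+(\alpha^\pm\rho^\pm (u^\pm)^2)_x+\alpha^\pm p_x=0,$$ with $\alpha^++\alpha^-=1$ and $\rho^\pm=R^\pm(p)$. Linearize it around a constant state with $\alpha^\pm\in(0,1)$, $\rho^\pm>0$ and $u^+=u^-=u_0\in\mathbb{R}$. Then all the eigenvalues of the linearized system lie in the set $\{u_0,\ u_0+c_0,\ u_0-c_0\}$, where $$c_0=\sqrt{\frac{(c^-)^2(c^+)^2\left(\alpha^+\rho^-+\alpha^-\rho^+\right)}{\alpha^+\rho^-(c^-)^2+\alpha^-\rho^+(c^+)^2}}.$$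
   Context: The two fluids are labelled $+$ and $-$; $\alpha^\pm$ are volume fractions, $\rho^\pm$ densities, $u^\pm$ velocities, $p$ the common pressure. There are four scalar equations for the four unknowns $W=(p,\alpha^+,u^+,u^-)$. The equations of state are smooth functions $\rho^\pm=R^\pm(p)>0$ with $dR^\pm/dp=1/(c^\pm)^2>0$, where $c^\pm>0$ is the speed of sound of the pure fluid $\pm$. Linearizing around a constant state (keeping first-order terms in the perturbation) gives a constant-coefficient system $M\,\partial_tW+N\,\partial_xW=0$ with $M$ invertible; its eigenvalues are the eigenvalues of $M^{-1}N$, i.e. the roots $\lambda$ of $\det(N-\lambda M)=0$. In the formula all quantities are evaluated at the constant state. *)

theory Defs
  imports "HOL-Analysis.Analysis"
begin

text \<open>
  Equation of state of one fluid on an open set \<open>P\<close> of admissible pressures: a smooth density law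
  \<open>R\<close> with speed of sound \<open>c\<close>. The values of \<open>R\<close> and \<open>c\<close> outside \<open>P\<close> are irrelevant.
\<close>

definition equation_of_state :: "real set \<Rightarrow> (real \<Rightarrow> real) \<Rightarrow> (real \<Rightarrow> real) \<Rightarrow> bool" where
  "equation_of_state P R c \<longleftrightarrow>
     open P \<and>
     (\<forall>n. \<forall>p\<in>P. (deriv ^^ n) R differentiable (at p)) \<and>
     (\<forall>p\<in>P. R p > 0 \<and> c p > 0 \<and> (R has_real_derivative 1 / (c p)\<^sup>2) (at p))"

text \<open>
  The unknowns are \<open>W = (p, \<alpha>\<^sup>+, u\<^sup>+, u\<^sup>-)\<close>, and \<open>\<alpha>\<^sup>- = 1 - \<alpha>\<^sup>+\<close> is eliminated. The masses and
  momenta per unit volume of mixture are \<open>\<alpha>\<^sup>\<plusminus>\<rho>\<^sup>\<plusminus>\<close> and \<open>\<alpha>\<^sup>\<plusminus>\<rho>\<^sup>\<plusminus>u\<^sup>\<plusminus>\<close>.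
\<close>

type_synonym state = "real ^ 4"

abbreviation pressure :: "state \<Rightarrow> real" where "pressure W \<equiv> W $ 1"
abbreviation alpha_plus :: "state \<Rightarrow> real" where "alpha_plus W \<equiv> W $ 2"
abbreviation alpha_minus :: "state \<Rightarrow> real" where "alpha_minus W \<equiv> 1 - W $ 2"
abbreviation vel_plus :: "state \<Rightarrow> real" where "vel_plus W \<equiv> W $ 3"
abbreviation vel_minus :: "state \<Rightarrow> real" where "vel_minus W \<equiv> W $ 4"

definition mass_plus :: "(real \<Rightarrow> real) \<Rightarrow> state \<Rightarrow> real" where
  "mass_plus Rp W = alpha_plus W * Rp (pressure W)"

definition mass_minus :: "(real \<Rightarrow> real) \<Rightarrow> state \<Rightarrow> real" where
  "mass_minus Rm W = alpha_minus W * Rm (pressure W)"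

text \<open>
  Left-hand sides of the four equations (mass \<open>+\<close>, mass \<open>-\<close>, momentum \<open>+\<close>, momentum \<open>-\<close>), evaluated
  on a field \<open>W t x\<close>. The two-fluid system says that this vector vanishes at every \<open>(t, x)\<close>.
\<close>

definition two_fluid ::
  "(real \<Rightarrow> real) \<Rightarrow> (real \<Rightarrow> real) \<Rightarrow> (real \<Rightarrow> real \<Rightarrow> state) \<Rightarrow> real \<Rightarrow> real \<Rightarrow> real ^ 4" where
  "two_fluid Rp Rm W t x = vector
    [deriv (\<lambda>s. mass_plus Rp (W s x)) t
       + deriv (\<lambda>y. mass_plus Rp (W t y) * vel_plus (W t y)) x,
     deriv (\<lambda>s. mass_minus Rm (W s x)) t
       + deriv (\<lambda>y. mass_minus Rm (W t y) * vel_minus (W t y)) x,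
     deriv (\<lambda>s. mass_plus Rp (W s x) * vel_plus (W s x)) t
       + deriv (\<lambda>y. mass_plus Rp (W t y) * (vel_plus (W t y))\<^sup>2) x
       + alpha_plus (W t x) * deriv (\<lambda>y. pressure (W t y)) x,
     deriv (\<lambda>s. mass_minus Rm (W s x) * vel_minus (W s x)) t
       + deriv (\<lambda>y. mass_minus Rm (W t y) * (vel_minus (W t y))\<^sup>2) x
       + alpha_minus (W t x) * deriv (\<lambda>y. pressure (W t y)) x]"

text \<open>
  \<open>M \<partial>\<^sub>tw + N \<partial>\<^sub>xw = 0\<close> is the linearization around the constant state \<open>W0\<close>: for every perturbation
  \<open>w\<close>, inserting \<open>W0 + \<epsilon> w\<close> into the system gives \<open>\<epsilon> (M \<partial>\<^sub>tw + N \<partial>\<^sub>xw)\<close> to first order in \<open>\<epsilon>\<close>.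
\<close>

definition is_linearization ::
  "(real \<Rightarrow> real) \<Rightarrow> (real \<Rightarrow> real) \<Rightarrow> state \<Rightarrow> real ^ 4 ^ 4 \<Rightarrow> real ^ 4 ^ 4 \<Rightarrow> bool" where
  "is_linearization Rp Rm W0 M N \<longleftrightarrow>
     (\<forall>(w :: real \<Rightarrow> real \<Rightarrow> state) t x wt wx.
        ((\<lambda>s. w s x) has_vector_derivative wt) (at t) \<longrightarrow>
        ((\<lambda>y. w t y) has_vector_derivative wx) (at x) \<longrightarrow>
        ((\<lambda>\<epsilon>. two_fluid Rp Rm (\<lambda>s y. W0 + \<epsilon> *\<^sub>R w s y) t x)
           has_vector_derivative (M *v wt + N *v wx)) (at 0))"

text \<open>Real matrices are considered over the complex numbers, so that non-real eigenvalues count.\<close>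

definition complex_eigenvalue :: "real ^ 'n ^ 'n \<Rightarrow> complex \<Rightarrow> bool" where
  "complex_eigenvalue A l \<longleftrightarrow>
     (\<exists>v :: complex ^ 'n. v \<noteq> 0 \<and> map_matrix complex_of_real A *v v = l *s v)"

end

theory Submission
  imports Defs
begin

text \<open>
  The system has the quasilinear form \<open>M(W) \<partial>\<^sub>tW + N(W) \<partial>\<^sub>xW\<close>, whose linearization around a constant
  state just evaluates \<open>M\<close> and \<open>N\<close> there. If \<open>N v = l M v\<close> with \<open>\<mu> = l - u0\<close>, subtracting
  \<open>u0\<close> times the mass rows from the momentum rows leaves \<open>v\<^sub>1 = \<rho>\<^sup>+ \<mu> v\<^sub>3 = \<rho>\<^sup>- \<mu> v\<^sub>4\<close>;
  eliminating \<open>v\<^sub>2\<close> from the mass rows then gives \<open>\<mu>\<^sup>2 = c0\<^sup>2\<close> unless \<open>\<mu> = 0\<close>.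
\<close>

section \<open>Quasilinear form of the two-fluid system\<close>

lemma vector_4 [simp]:
  fixes a b c d :: "'a :: zero"
  shows "(vector [a, b, c, d] :: 'a ^ 4) $ 1 = a" "(vector [a, b, c, d] :: 'a ^ 4) $ 2 = b"
    "(vector [a, b, c, d] :: 'a ^ 4) $ 3 = c" "(vector [a, b, c, d] :: 'a ^ 4) $ 4 = d"
  by (simp_all add: vector_def)

definition time_matrix :: "(real \<Rightarrow> real) \<Rightarrow> (real \<Rightarrow> real) \<Rightarrow> state \<Rightarrow> real ^ 4 ^ 4" where
  "time_matrix Rp Rm W =
    (let p = pressure W; a = alpha_plus W; b = alpha_minus W; u = vel_plus W; v = vel_minus W in
     vector
      [vector [a * deriv Rp p, Rp p, 0, 0],
       vector [b * deriv Rm p, - Rm p, 0, 0],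
       vector [a * deriv Rp p * u, Rp p * u, a * Rp p, 0],
       vector [b * deriv Rm p * v, - Rm p * v, 0, b * Rm p]])"

text \<open>Jacobian of the mass and momentum fluxes. The nonconservative pressure terms contribute
  the summands \<open>a\<close> and \<open>b\<close> in the first column.\<close>

definition space_matrix :: "(real \<Rightarrow> real) \<Rightarrow> (real \<Rightarrow> real) \<Rightarrow> state \<Rightarrow> real ^ 4 ^ 4" where
  "space_matrix Rp Rm W =
    (let p = pressure W; a = alpha_plus W; b = alpha_minus W; u = vel_plus W; v = vel_minus W in
     vector
      [vector [a * deriv Rp p * u, Rp p * u, a * Rp p, 0],
       vector [b * deriv Rm p * v, - Rm p * v, 0, b * Rm p],
       vector [a * deriv Rp p * u\<^sup>2 + a, Rp p * u\<^sup>2, 2 * a * Rp p * u, 0],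
       vector [b * deriv Rm p * v\<^sup>2 + b, - Rm p * v\<^sup>2, 0, 2 * b * Rm p * v]])"

lemma has_real_derivative_vec_nth:
  fixes W :: "real \<Rightarrow> real ^ 'n"
  assumes "(W has_vector_derivative D) (at s)"
  shows "((\<lambda>s. W s $ i) has_real_derivative D $ i) (at s)"
  using bounded_linear.has_vector_derivative[OF bounded_linear_vec_nth assms]
  by (simp add: has_real_derivative_iff_has_vector_derivative)

lemma mass_plus_has_real_derivative:
  assumes W: "(W has_vector_derivative D) (at s)"
    and R: "R differentiable at (pressure (W s))"
  shows "((\<lambda>s. mass_plus R (W s)) has_real_derivative
    D $ 2 * R (pressure (W s)) + alpha_plus (W s) * (deriv R (pressure (W s)) * D $ 1)) (at s)"
proof -
  have "(R has_real_derivative deriv R (pressure (W s))) (at (pressure (W s)))"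
    using R DERIV_deriv_iff_real_differentiable by blast
  from DERIV_chain2[OF this has_real_derivative_vec_nth[OF W]] show ?thesis
    unfolding mass_plus_def
    by (auto intro!: derivative_eq_intros has_real_derivative_vec_nth[OF W])
qed

lemma mass_minus_has_real_derivative:
  assumes W: "(W has_vector_derivative D) (at s)"
    and R: "R differentiable at (pressure (W s))"
  shows "((\<lambda>s. mass_minus R (W s)) has_real_derivative
    - D $ 2 * R (pressure (W s)) + alpha_minus (W s) * (deriv R (pressure (W s)) * D $ 1)) (at s)"
proof -
  have "(R has_real_derivative deriv R (pressure (W s))) (at (pressure (W s)))"
    using R DERIV_deriv_iff_real_differentiable by blast
  from DERIV_chain2[OF this has_real_derivative_vec_nth[OF W]] show ?thesis
    unfolding mass_minus_def
    by (auto intro!: derivative_eq_intros has_real_derivative_vec_nth[OF W])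
qed

text \<open>Product and chain rules at a single point. Only the two partial derivatives of
  \<open>W\<close> there enter, which is all that \<open>is_linearization\<close> provides about a
  perturbation.\<close>

lemma two_fluid_quasilinear:
  assumes Wt: "((\<lambda>s. W s x) has_vector_derivative Wt) (at t)"
    and Wx: "((\<lambda>y. W t y) has_vector_derivative Wx) (at x)"
    and R: "Rp differentiable at (pressure (W t x))" "Rm differentiable at (pressure (W t x))"
  shows "two_fluid Rp Rm W t x =
    time_matrix Rp Rm (W t x) *v Wt + space_matrix Rp Rm (W t x) *v Wx"
proof -
  note vt = has_real_derivative_vec_nth[OF Wt] and vx = has_real_derivative_vec_nth[OF Wx]
  note pt = mass_plus_has_real_derivative[OF Wt R(1)] and px = mass_plus_has_real_derivative[OF Wx R(1)]
  note mt = mass_minus_has_real_derivative[OF Wt R(2)] and mx = mass_minus_has_real_derivative[OF Wx R(2)]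
  note derivs = vx[THEN DERIV_imp_deriv] pt[THEN DERIV_imp_deriv] mt[THEN DERIV_imp_deriv]
    DERIV_mult[OF pt vt, THEN DERIV_imp_deriv] DERIV_mult[OF mt vt, THEN DERIV_imp_deriv]
    DERIV_mult[OF px vx, THEN DERIV_imp_deriv] DERIV_mult[OF mx vx, THEN DERIV_imp_deriv]
    DERIV_mult[OF px DERIV_power[OF vx, of _ 2], THEN DERIV_imp_deriv]
    DERIV_mult[OF mx DERIV_power[OF vx, of _ 2], THEN DERIV_imp_deriv]
  show ?thesis
    unfolding two_fluid_def vec_eq_iff forall_4 vector_4 derivs
    by (simp add: time_matrix_def space_matrix_def matrix_vector_mult_def sum_4 Let_def
        mass_plus_def mass_minus_def algebra_simps)
qed

section \<open>Linearization around a constant state\<close>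

text \<open>The difference quotient of \<open>f\<close> at 0 is \<open>g\<close> itself, which tends
  to \<open>g 0\<close>. So the matrices enter a linearization only through their values at the
  constant state, not through their derivatives.\<close>

lemma has_vector_derivative_scaleR_at_0:
  fixes g :: "real \<Rightarrow> 'a :: real_normed_vector"
  assumes g: "isCont g 0" and f: "eventually (\<lambda>e. f e = e *\<^sub>R g e) (nhds 0)"
  shows "(f has_vector_derivative g 0) (at 0)"
proof -
  have f0: "f 0 = 0" using eventually_nhds_x_imp_x[OF f] by simp
  have "((\<lambda>e. f e /\<^sub>R e) \<longlongrightarrow> g 0) (at 0)"
  proof (rule Lim_transform_eventually)
    show "(g \<longlongrightarrow> g 0) (at 0)" using g by (simp add: isCont_def)
    have "eventually (\<lambda>e. f e = e *\<^sub>R g e) (at 0)"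
      using f by (simp add: eventually_nhds_conv_at)
    then show "eventually (\<lambda>e. g e = f e /\<^sub>R e) (at 0)"
      using eventually_neq_at_within[of 0] by eventually_elim simp
  qed
  then have "((\<lambda>e. norm (f e /\<^sub>R e - g 0)) \<longlongrightarrow> 0) (at 0)"
    using tendsto_norm_zero LIM_zero by blast
  moreover have "eventually (\<lambda>e. norm (f e /\<^sub>R e - g 0) = norm (f e - f 0 - (e - 0) *\<^sub>R g 0) / norm (e - 0)) (at 0)"
    using eventually_neq_at_within[of 0]
  proof eventually_elim
    case (elim e)
    have "f e /\<^sub>R e - g 0 = inverse e *\<^sub>R (f e - e *\<^sub>R g 0)"
      using elim by (simp add: scaleR_diff_right)
    then show ?case using elim by (simp add: f0 divide_inverse)
  qed
  ultimately have "((\<lambda>e. norm (f e - f 0 - (e - 0) *\<^sub>R g 0) / norm (e - 0)) \<longlongrightarrow> 0) (at 0)"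
    by (rule Lim_transform_eventually)
  then show ?thesis
    by (simp add: has_vector_derivative_def has_derivative_iff_norm bounded_linear_scaleR_left)
qed

lemma equation_of_stateD:
  assumes "equation_of_state P R c" "p \<in> P"
  shows "R p > 0" "c p > 0" "deriv R p = 1 / (c p)\<^sup>2" "R differentiable at p" "isCont (deriv R) p"
proof -
  have n: "(deriv ^^ n) R differentiable at p" for n
    using assms by (auto simp: equation_of_state_def)
  show "R p > 0" "c p > 0" "deriv R p = 1 / (c p)\<^sup>2"
    using assms by (auto simp: equation_of_state_def intro: DERIV_imp_deriv)
  show "R differentiable at p" using n[of 0] by simp
  \<comment> \<open>Continuity comes from the differentiability of \<open>deriv R\<close>, since
    \<open>c\<close> carries no continuity assumption of its own.\<close>
  show "isCont (deriv R) p" using n[of 1] by (simp add: differentiable_imp_continuous_within)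
qed

text \<open>As \<open>W0\<close> is constant, the derivatives of the perturbed field are
  \<open>e\<close> times those of \<open>w\<close>. The quasilinear form therefore carries an
  overall factor \<open>e\<close>, and what remains is continuous in \<open>e\<close>.\<close>

lemma quasilinear_is_linearization:
  assumes P: "open P" "pressure W0 \<in> P"
    and R: "\<And>p. p \<in> P \<Longrightarrow> Rp differentiable at p" "\<And>p. p \<in> P \<Longrightarrow> Rm differentiable at p"
    and cont: "isCont (deriv Rp) (pressure W0)" "isCont (deriv Rm) (pressure W0)"
  shows "is_linearization Rp Rm W0 (time_matrix Rp Rm W0) (space_matrix Rp Rm W0)"
  unfolding is_linearization_def
proof (intro allI impI)
  fix w :: "real \<Rightarrow> real \<Rightarrow> state" and t x wt wx
  assume wt: "((\<lambda>s. w s x) has_vector_derivative wt) (at t)"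
    and wx: "((\<lambda>y. w t y) has_vector_derivative wx) (at x)"
  \<comment> \<open>\<open>V e\<close> is the perturbed state at \<open>(t, x)\<close>;
    \<open>g e\<close> is the system there with the factor \<open>e\<close> taken out.\<close>
  define V where "V e = W0 + e *\<^sub>R w t x" for e
  define g where "g e = time_matrix Rp Rm (V e) *v wt + space_matrix Rp Rm (V e) *v wx" for e
  have V0: "V 0 = W0" by (simp add: V_def)
  have V: "isCont (\<lambda>e. V e $ i) 0" for i
    unfolding V_def by (intro continuous_intros)
  have comp: "isCont (\<lambda>e. h (V e $ 1)) 0" if "isCont h (pressure W0)" for h :: "real \<Rightarrow> real"
    using isCont_o2[of 0 "\<lambda>e. V e $ 1" h] that V by (simp add: V0)
  have RC: "isCont Rp (pressure W0)" "isCont Rm (pressure W0)"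
    using R P by (auto intro: differentiable_imp_continuous_within)
  note ci = V comp[OF RC(1)] comp[OF RC(2)] comp[OF cont(1)] comp[OF cont(2)]
  have "\<forall>i. isCont (\<lambda>e. g e $ i) 0"
    unfolding forall_4 g_def time_matrix_def space_matrix_def matrix_vector_mult_def Let_def
      vector_add_component vec_lambda_beta sum_4 vector_4
    by (intro conjI ci isCont_add isCont_diff isCont_minus isCont_mult isCont_power continuous_const)
  then have gc: "isCont g 0"
    unfolding isCont_def by (auto intro: vec_tendstoI)
  \<comment> \<open>Openness of \<open>P\<close> keeps the perturbed pressure admissible for small
    \<open>e\<close>, so both density laws stay differentiable there.\<close>
  have "eventually (\<lambda>e. V e $ 1 \<in> P) (at 0)"
    using topological_tendstoD[OF V[of 1, unfolded isCont_def V0] P] .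
  then have ev: "eventually (\<lambda>e. V e $ 1 \<in> P) (nhds 0)"
    using P(2) by (simp add: eventually_nhds_conv_at V0)
  have "eventually (\<lambda>e. two_fluid Rp Rm (\<lambda>s y. W0 + e *\<^sub>R w s y) t x = e *\<^sub>R g e) (nhds 0)"
    using ev
  proof eventually_elim
    case (elim e)
    have "((\<lambda>s. W0 + e *\<^sub>R w s x) has_vector_derivative e *\<^sub>R wt) (at t)"
      "((\<lambda>y. W0 + e *\<^sub>R w t y) has_vector_derivative e *\<^sub>R wx) (at x)"
      using wt wx by (auto intro!: derivative_eq_intros)
    from two_fluid_quasilinear[of "\<lambda>s y. W0 + e *\<^sub>R w s y", OF this R[OF elim[unfolded V_def]]]
    show ?case
      by (simp add: g_def V_def matrix_vector_mult_scaleR scaleR_add_right)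
  qed
  from has_vector_derivative_scaleR_at_0[OF gc this]
  show "((\<lambda>e. two_fluid Rp Rm (\<lambda>s y. W0 + e *\<^sub>R w s y) t x) has_vector_derivative
      time_matrix Rp Rm W0 *v wt + space_matrix Rp Rm W0 *v wx) (at 0)"
    by (simp add: g_def V0)
qed

text \<open>Perturbations linear in time and space realize every pair of derivatives at the origin,
  where the derivative in \<epsilon> is unique. This reduces a claim about all linearizations to the
  explicit matrices.\<close>

lemma is_linearization_unique:
  assumes "is_linearization Rp Rm W0 M N" "is_linearization Rp Rm W0 M' N'"
  shows "M = M'" "N = N'"
proof -
  have eq: "M *v a + N *v b = M' *v a + N' *v b" for a b
  proof -
    define w :: "real \<Rightarrow> real \<Rightarrow> state" where "w s y = s *\<^sub>R a + y *\<^sub>R b" for s y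
    have "((\<lambda>s. w s 0) has_vector_derivative a) (at 0)" "((\<lambda>y. w 0 y) has_vector_derivative b) (at 0)"
      unfolding w_def by (auto intro!: derivative_eq_intros)
    then show ?thesis
      using assms vector_derivative_unique_at unfolding is_linearization_def by blast
  qed
  \<comment> \<open>A zero space derivative isolates the time matrices, and conversely.\<close>
  show "M = M'" using eq[of _ 0] by (simp add: matrix_eq)
  show "N = N'" using eq[of 0] by (simp add: matrix_eq)
qed

section \<open>Complex eigenvalues of the matrix pencil\<close>

lemma matrix_inv_mult_right:
  fixes A :: "'a :: semiring_1 ^ 'n ^ 'm"
  assumes "invertible A"
  shows "A ** matrix_inv A = mat 1"
  using assms unfolding invertible_def matrix_inv_def by (rule someI2_ex) simp

lemma map_matrix_of_real_mult:
  "map_matrix complex_of_real (A ** B) = map_matrix complex_of_real A ** map_matrix complex_of_real B"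
  by (simp add: vec_eq_iff matrix_matrix_mult_def)

text \<open>Multiplying the eigenvalue equation by \<open>M\<close> from the left gives the pencil
  form, so the inverse of \<open>M\<close> never has to be computed.\<close>

lemma complex_eigenvalue_pencil:
  assumes M: "invertible M" and l: "complex_eigenvalue (matrix_inv M ** N) l"
  obtains v where "v \<noteq> 0"
    "map_matrix complex_of_real N *v v = l *s (map_matrix complex_of_real M *v v)"
proof -
  let ?C = "map_matrix complex_of_real"
  obtain v where v: "v \<noteq> 0" "?C (matrix_inv M ** N) *v v = l *s v"
    using l by (auto simp: complex_eigenvalue_def)
  have "?C N = ?C M ** ?C (matrix_inv M ** N)"
    unfolding map_matrix_of_real_mult[symmetric]
    by (simp add: matrix_mul_assoc matrix_inv_mult_right[OF M])
  then have "?C N *v v = ?C M *v (l *s v)"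
    by (simp add: matrix_vector_mul_assoc[symmetric] v(2))
  then show ?thesis using that v(1) by (simp add: vector_scalar_commute)
qed

text \<open>The kernel is trivial: the mass rows form a nonsingular system in the first two
  components, and the momentum rows then kill the other two.\<close>

lemma time_matrix_invertible:
  assumes "0 < alpha_plus W" "0 < alpha_minus W" "0 < Rp (pressure W)" "0 < Rm (pressure W)"
    "0 < deriv Rp (pressure W)" "0 < deriv Rm (pressure W)"
  shows "invertible (time_matrix Rp Rm W)"
  unfolding invertible_left_inverse matrix_left_invertible_ker
proof (intro allI impI)
  fix v assume "time_matrix Rp Rm W *v v = 0"
  moreover define a b r s r' s' where "a = alpha_plus W" "b = alpha_minus W" "r = Rp (pressure W)"
    "s = Rm (pressure W)" "r' = deriv Rp (pressure W)" "s' = deriv Rm (pressure W)"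
  note d = this
  ultimately have e: "a * r' * v $ 1 + r * v $ 2 = 0" "b * s' * v $ 1 - s * v $ 2 = 0"
    "a * r' * vel_plus W * v $ 1 + r * vel_plus W * v $ 2 + a * r * v $ 3 = 0"
    "b * s' * vel_minus W * v $ 1 - s * vel_minus W * v $ 2 + b * s * v $ 4 = 0"
    by (simp_all add: time_matrix_def Let_def vec_eq_iff forall_4 matrix_vector_mult_def sum_4)
  have pos: "0 < a" "0 < b" "0 < r" "0 < s" "0 < r'" "0 < s'" using assms by (simp_all add: d)
  \<comment> \<open>\<open>s\<close> times the first mass equation plus \<open>r\<close> times the
    second eliminates \<open>v $ 2\<close>.\<close>
  have "(a * r' * s + b * s' * r) * v $ 1 = 0" using e(1,2) by algebra
  moreover have "a * r' * s + b * s' * r > 0" using pos by (simp add: add_pos_pos)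
  ultimately have v1: "v $ 1 = 0" by simp
  then have v2: "v $ 2 = 0" using e(1) pos by simp
  have "v $ 3 = 0" "v $ 4 = 0" using e(3,4) v1 v2 pos by simp_all
  with v1 v2 show "v = 0" by (simp add: vec_eq_iff forall_4)
qed

text \<open>The quotient is the square of \<open>c0\<close>, still written with the derivatives
  \<open>r'\<close> and \<open>s'\<close> of the density laws instead of the speeds of
  sound.\<close>

lemma pencil_eigenvalue:
  fixes v :: "complex ^ 4"
  assumes u: "vel_plus W = u" "vel_minus W = u"
    and defs: "a = alpha_plus W" "b = alpha_minus W" "r = Rp (pressure W)"
      "s = Rm (pressure W)" "r' = deriv Rp (pressure W)" "s' = deriv Rm (pressure W)"
    and pos: "0 < a" "0 < b" "0 < r" "0 < s" "0 < r'" "0 < s'"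
    and v: "v \<noteq> 0" "map_matrix complex_of_real (space_matrix Rp Rm W) *v v =
      l *s (map_matrix complex_of_real (time_matrix Rp Rm W) *v v)"
  shows "l = of_real u \<or> (l - of_real u)\<^sup>2 = of_real ((a * s + b * r) / (a * r' * s + b * s' * r))"
proof (cases "l = of_real u")
  case False
  define A B R S R' S' U where "A = complex_of_real a" "B = complex_of_real b"
    "R = complex_of_real r" "S = complex_of_real s" "R' = complex_of_real r'"
    "S' = complex_of_real s'" "U = complex_of_real u"
  note d = this
  define \<mu> where "\<mu> = l - U"
  have l: "l = U + \<mu>" by (simp add: \<mu>_def)
  have \<mu>: "\<mu> \<noteq> 0" using False by (simp add: \<mu>_def d)
  have nz: "A \<noteq> 0" "B \<noteq> 0" "R \<noteq> 0" "S \<noteq> 0" using pos by (simp_all add: d)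
  have e: "A * R' * U * v $ 1 + R * U * v $ 2 + A * R * v $ 3 = l * (A * R' * v $ 1 + R * v $ 2)"
    "B * S' * U * v $ 1 - S * U * v $ 2 + B * S * v $ 4 = l * (B * S' * v $ 1 - S * v $ 2)"
    "(A * R' * U\<^sup>2 + A) * v $ 1 + R * U\<^sup>2 * v $ 2 + 2 * A * R * U * v $ 3
      = l * (A * R' * U * v $ 1 + R * U * v $ 2 + A * R * v $ 3)"
    "(B * S' * U\<^sup>2 + B) * v $ 1 - S * U\<^sup>2 * v $ 2 + 2 * B * S * U * v $ 4
      = l * (B * S' * U * v $ 1 - S * U * v $ 2 + B * S * v $ 4)"
    using v(2) u unfolding defs d
    by (simp_all add: time_matrix_def space_matrix_def Let_def vec_eq_iff forall_4
        matrix_vector_mult_def sum_4)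
  \<comment> \<open>Shifting \<open>l\<close> by the common velocity cancels the transport terms in
    the mass rows.\<close>
  have m: "A * R * v $ 3 = \<mu> * (A * R' * v $ 1 + R * v $ 2)"
    "B * S * v $ 4 = \<mu> * (B * S' * v $ 1 - S * v $ 2)"
    using e(1,2) unfolding l by algebra+
  \<comment> \<open>Momentum row minus \<open>U\<close> times the mass row of the same
    fluid.\<close>
  have "A * v $ 1 = A * (R * \<mu> * v $ 3)"
    using e(1,3) unfolding l by algebra
  moreover have "B * v $ 1 = B * (S * \<mu> * v $ 4)"
    using e(2,4) unfolding l by algebra
  ultimately have v1: "v $ 1 = R * \<mu> * v $ 3" "v $ 1 = S * \<mu> * v $ 4" using nz by simp_all
  \<comment> \<open>Without a pressure component the whole eigenvector would vanish, as \<mu> is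
    nonzero; hence \<open>v $ 1\<close> can be cancelled below.\<close>
  have "v $ 1 \<noteq> 0"
  proof
    assume "v $ 1 = 0"
    moreover from this have "v $ 3 = 0" "v $ 4 = 0" using v1 nz \<mu> by simp_all
    moreover from calculation have "v $ 2 = 0" using m(1) nz \<mu> by simp
    ultimately show False using v(1) by (simp add: vec_eq_iff forall_4)
  qed
  moreover have "v $ 1 * (\<mu>\<^sup>2 * (A * R' * S + B * S' * R)) = v $ 1 * (A * S + B * R)"
  proof -
    \<comment> \<open>Weighting the mass rows by \<open>S\<close> and \<open>R\<close> cancels
      \<open>v $ 2\<close>; the extra factor \<mu> turns the velocity components into
      \<open>v $ 1\<close>.\<close>
    have "v $ 1 * (\<mu>\<^sup>2 * (A * R' * S + B * S' * R)) =
        \<mu> * (S * (\<mu> * (A * R' * v $ 1 + R * v $ 2)) + R * (\<mu> * (B * S' * v $ 1 - S * v $ 2)))"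
      by (simp add: algebra_simps power2_eq_square)
    also have "\<dots> = A * S * (R * \<mu> * v $ 3) + B * R * (S * \<mu> * v $ 4)"
      unfolding m[symmetric] by (simp add: algebra_simps)
    finally show ?thesis
      unfolding v1[symmetric] by (simp add: algebra_simps)
  qed
  ultimately have "\<mu>\<^sup>2 * (A * R' * S + B * S' * R) = A * S + B * R" by simp
  moreover have "A * R' * S + B * S' * R = of_real (a * r' * s + b * s' * r)"
    by (simp add: d)
  moreover have "a * r' * s + b * s' * r > 0" using pos by (simp add: add_pos_pos)
  then have "complex_of_real (a * r' * s + b * s' * r) \<noteq> 0"
    by (simp only: of_real_eq_0_iff)
  ultimately have "\<mu>\<^sup>2 = (A * S + B * R) / (A * R' * S + B * S' * R)"
    by (simp add: eq_divide_eq)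
  then show ?thesis by (simp add: \<mu>_def d)
qed simp

theorem mainTheorem2:
  fixes P :: "real set" and Rp Rm cp cm :: "real \<Rightarrow> real"
    and p0 ap am rp rm u0 c0 :: real and W0 :: state
  assumes eos_plus: "equation_of_state P Rp cp"
    and eos_minus: "equation_of_state P Rm cm"
    and p0: "p0 \<in> P"
    and ap: "0 < ap" "ap < 1"
    and am: "0 < am" "am < 1"
    and saturation: "ap + am = 1"
    and rp: "rp = Rp p0"
    and rm: "rm = Rm p0"
    and W0: "W0 = vector [p0, ap, u0, u0]"
    and c0: "c0 = sqrt (((cm p0)\<^sup>2 * (cp p0)\<^sup>2 * (ap * rm + am * rp)) /
                        (ap * rm * (cm p0)\<^sup>2 + am * rp * (cp p0)\<^sup>2))"
  shows "(\<exists>M N. is_linearization Rp Rm W0 M N) \<and>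
         (\<forall>M N. is_linearization Rp Rm W0 M N \<longrightarrow>
            invertible M \<and>
            {l. complex_eigenvalue (matrix_inv M ** N) l}
              \<subseteq> {complex_of_real u0, complex_of_real (u0 + c0), complex_of_real (u0 - c0)})"
proof -
  note Dp = equation_of_stateD[OF eos_plus] and Dm = equation_of_stateD[OF eos_minus]
  have W: "pressure W0 = p0" "alpha_plus W0 = ap" "alpha_minus W0 = am"
    "vel_plus W0 = u0" "vel_minus W0 = u0"
    using saturation by (auto simp: W0)
  have "open P" using eos_plus by (simp add: equation_of_state_def)
  then have lin: "is_linearization Rp Rm W0 (time_matrix Rp Rm W0) (space_matrix Rp Rm W0)"
    using Dp Dm p0 by (intro quasilinear_is_linearization) (auto simp: W)
  have pos: "0 < rp" "0 < rm" "0 < cp p0" "0 < cm p0" using Dp Dm p0 by (auto simp: rp rm)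
  have dpos: "0 < deriv Rp p0" "0 < deriv Rm p0" using Dp(3) Dm(3) p0 pos by simp_all
  have inv: "invertible (time_matrix Rp Rm W0)"
    using ap am pos dpos by (intro time_matrix_invertible) (simp_all add: W rp[symmetric] rm[symmetric])
  have c0_sq: "(ap * rm + am * rp) / (ap * deriv Rp p0 * rm + am * deriv Rm p0 * rp) = c0\<^sup>2"
  proof -
    have "c0\<^sup>2 = ((cm p0)\<^sup>2 * (cp p0)\<^sup>2 * (ap * rm + am * rp)) /
        (ap * rm * (cm p0)\<^sup>2 + am * rp * (cp p0)\<^sup>2)"
      unfolding c0 using ap am pos by (intro real_sqrt_pow2) (simp add: add_pos_pos less_imp_le)
    \<comment> \<open>Each derivative of a density law is the inverse square of the speed of sound,
      so the product of both squares factors out of the denominator.\<close>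
    also have "ap * rm * (cm p0)\<^sup>2 + am * rp * (cp p0)\<^sup>2 =
        ((cm p0)\<^sup>2 * (cp p0)\<^sup>2) * (ap * deriv Rp p0 * rm + am * deriv Rm p0 * rp)"
      using pos by (simp add: Dp(3) Dm(3) p0 field_simps)
    finally show ?thesis using pos by simp
  qed
  have "l \<in> {complex_of_real u0, complex_of_real (u0 + c0), complex_of_real (u0 - c0)}"
    if ev: "complex_eigenvalue (matrix_inv (time_matrix Rp Rm W0) ** space_matrix Rp Rm W0) l" for l
  proof -
    obtain v where "v \<noteq> 0" "map_matrix complex_of_real (space_matrix Rp Rm W0) *v v =
        l *s (map_matrix complex_of_real (time_matrix Rp Rm W0) *v v)"
      using complex_eigenvalue_pencil[OF inv ev] .
    then have "l = of_real u0 \<or> (l - of_real u0)\<^sup>2 =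
        of_real ((ap * rm + am * rp) / (ap * deriv Rp p0 * rm + am * deriv Rm p0 * rp))"
      using ap am pos dpos saturation
      by (intro pencil_eigenvalue[where W = W0]) (simp_all add: W(1,2,4,5) rp rm)
    then have "l = of_real u0 \<or> (l - of_real u0)\<^sup>2 = (of_real c0)\<^sup>2"
      unfolding c0_sq by simp
    then show ?thesis by (auto simp: power2_eq_iff algebra_simps)
  qed
  \<comment> \<open>By uniqueness, every linearization is the explicit pair, so invertibility and
    the eigenvalue inclusion carry over to it.\<close>
  then show ?thesis using lin inv is_linearization_unique[OF _ lin] by blast
qed

end
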